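(* For any $\zeta>0$ there is $C_0>1$ such that the following holds. Let $\varepsilon,p,q\in(0,\tfrac12)$ with $q\ge(1+\zeta)p$, let $C>C_0$, and write $r=C\log\varepsilon^{-1}$ and $\delta=C^{-r}$. Then any monotone $(r,\delta)$-global Boolean function $f\colon\{0,1\}^n\to\{0,1\}$ with $\mu_p(f)\le\delta$ satisfies $\mu_q(f)\ge\varepsilon^{-1}\mu_p(f)$.
   Context: $\mu_x$ is the $x$-biased product measure on $\{0,1\}^n$, $\mu_x(f)=\mathbb{E}_{\mu_x}[f]$. $f$ is monotone if $f(x)\le f(y)$ whenever $x_i\le y_i$ for all $i$. $f$ is $(r,\delta)$-global (with respect to $\mu_p$) if $\mu_p(f_{J\to1})\le\mu_p(f)+\delta$ for every $J\subseteq[n]$ with $|J|\le r$, where $f_{J\to1}$ is the restriction setting the coordinates in $J$ to $1$. *)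

theory Defs
  imports "HOL-Probability.Probability" "HOL-Probability.Product_PMF"
begin

text \<open>
  The discrete cube on an index set \<open>A\<close>, with \<open>True\<close> for 1 and \<open>False\<close> for 0. Points are total
  functions that are \<open>False\<close> outside \<open>A\<close>, which makes the pointwise order on \<open>nat \<Rightarrow> bool\<close> the
  coordinatewise order of the cube and matches the support of \<open>Pi_pmf A False\<close>.
\<close>

definition cube :: "nat set \<Rightarrow> (nat \<Rightarrow> bool) set" where
  "cube A = PiE_dflt A False (\<lambda>_. UNIV)"

definition boolean_function :: "nat \<Rightarrow> ((nat \<Rightarrow> bool) \<Rightarrow> real) \<Rightarrow> bool" where
  "boolean_function n f \<longleftrightarrow> f \<in> cube {1..n} \<rightarrow> {0, 1}"

definition biased_measure :: "nat set \<Rightarrow> real \<Rightarrow> (nat \<Rightarrow> bool) pmf" where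
  "biased_measure A p = Pi_pmf A False (\<lambda>_. bernoulli_pmf p)"

definition mu :: "nat set \<Rightarrow> real \<Rightarrow> ((nat \<Rightarrow> bool) \<Rightarrow> real) \<Rightarrow> real" where
  "mu A p f = measure_pmf.expectation (biased_measure A p) f"

text \<open>If \<open>f\<close> lives on \<open>cube A\<close>, then \<open>restrict_to_one f J\<close> lives on \<open>cube (A - J)\<close>.\<close>

definition restrict_to_one :: "((nat \<Rightarrow> bool) \<Rightarrow> real) \<Rightarrow> nat set \<Rightarrow> (nat \<Rightarrow> bool) \<Rightarrow> real" where
  "restrict_to_one f J = (\<lambda>y. f (\<lambda>i. if i \<in> J then True else y i))"

definition global_function ::
    "nat \<Rightarrow> real \<Rightarrow> real \<Rightarrow> real \<Rightarrow> ((nat \<Rightarrow> bool) \<Rightarrow> real) \<Rightarrow> bool" where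
  "global_function n p r \<delta> f \<longleftrightarrow>
     (\<forall>J \<subseteq> {1..n}. real (card J) \<le> r \<longrightarrow>
        mu ({1..n} - J) p (restrict_to_one f J) \<le> mu {1..n} p f + \<delta>)"

end

theory Submission
  imports Defs
begin

text \<open>
  Write \<open>f = \<Sum>S. c S * \<Prod>i\<in>S. (x i - p)\<close> and \<open>v = p * (1 - p)\<close>. Couple \<open>x \<sim> \<mu>_p\<close>
  and \<open>y \<sim> \<mu>_q\<close> so that \<open>x \<le> y\<close>. As \<open>f\<close> is monotone,
  \<open>\<mu>_p f = E[f x * f y] = E_q[f * T f]\<close>, where the one-sided noise operator \<open>T\<close> damps level
  \<open>k\<close> in \<open>L\<^sup>2\<close> by \<open>(1 + \<zeta>) powr (- k / 2)\<close>. Levels above \<open>d\<close>, of order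
  \<open>ln (1 / \<epsilon>)\<close>, are therefore negligible unless \<open>\<mu>_q f \<ge> \<mu>_p f / \<epsilon>\<close>. The low levels carry
  weight \<open>W\<close> with \<open>W ^ 3 \<le> 128 ^ d * 2 * \<delta> * (\<mu>_p f) ^ 3\<close>: globalness and monotonicity bound
  all generalised influences of order at most \<open>d\<close>, a hypercontractive inequality turns this into a
  bound on the fourth moment of the low-degree part of \<open>f\<close>, and Hoelder's inequality concludes.
\<close>

section \<open>Finite expectations over the biased cube\<close>

lemma cube_iff: "x \<in> cube A \<longleftrightarrow> (\<forall>j. j \<notin> A \<longrightarrow> \<not> x j)"
  by (auto simp: cube_def PiE_dflt_def)

lemma finite_cube: "finite A \<Longrightarrow> finite (cube A)"
  unfolding cube_def by (rule finite_PiE_dflt) auto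

lemma set_biased_measure: "finite A \<Longrightarrow> set_pmf (biased_measure A p) \<subseteq> cube A"
  unfolding biased_measure_def cube_def using set_Pi_pmf_subset[of A False "\<lambda>_. bernoulli_pmf p"] 
  by (auto simp: PiE_dflt_def)

lemma mu_eq_sum:
  assumes "finite A"
  shows "mu A p f = (\<Sum>x\<in>cube A. pmf (biased_measure A p) x * f x)"
  unfolding mu_def
  by (subst integral_measure_pmf[where A = "cube A"])
     (use assms set_biased_measure in \<open>auto simp: finite_cube\<close>)

lemma mu_mono: "finite A \<Longrightarrow> (\<And>x. x \<in> cube A \<Longrightarrow> f x \<le> g x) \<Longrightarrow> mu A p f \<le> mu A p g"
  by (auto simp: mu_eq_sum intro!: sum_mono mult_left_mono)

lemma mu_cong: "finite A \<Longrightarrow> (\<And>x. x \<in> cube A \<Longrightarrow> f x = g x) \<Longrightarrow> mu A p f = mu A p g"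
  by (auto simp: mu_eq_sum intro!: sum.cong)

lemma mu_nonneg: "finite A \<Longrightarrow> (\<And>x. x \<in> cube A \<Longrightarrow> 0 \<le> f x) \<Longrightarrow> 0 \<le> mu A p f"
  by (auto simp: mu_eq_sum intro!: sum_nonneg)

lemma mu_add: "finite A \<Longrightarrow> mu A p (\<lambda>x. f x + g x) = mu A p f + mu A p g"
  by (simp add: mu_eq_sum algebra_simps sum.distrib)

lemma mu_cmult: "finite A \<Longrightarrow> mu A p (\<lambda>x. k * f x) = k * mu A p f"
  by (simp add: mu_eq_sum algebra_simps sum_distrib_left)

lemma mu_Cauchy_Schwarz:
  assumes "finite A"
  shows "(mu A p (\<lambda>x. f x * g x))\<^sup>2 \<le> mu A p (\<lambda>x. (f x)\<^sup>2) * mu A p (\<lambda>x. (g x)\<^sup>2)"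
proof -
  let ?w = "\<lambda>x. sqrt (pmf (biased_measure A p) x)"
  have "(\<Sum>x\<in>cube A. (?w x * f x) * (?w x * g x))\<^sup>2
      \<le> (\<Sum>x\<in>cube A. (?w x * f x)\<^sup>2) * (\<Sum>x\<in>cube A. (?w x * g x)\<^sup>2)"
    by (rule Cauchy_Schwarz_ineq_sum)
  moreover have "(?w x * f x) * (?w x * g x) = pmf (biased_measure A p) x * (f x * g x)" for x
    by (simp add: algebra_simps flip: mult.assoc power2_eq_square)
  ultimately show ?thesis
    using assms by (simp add: mu_eq_sum power_mult_distrib)
qed

lemma mu_empty: "mu {} p f = f (\<lambda>_. False)"
  by (simp add: mu_def biased_measure_def)

text \<open>Conditioning on the coordinate \<open>i\<close>; the inductive proofs about moments
  below use it to reduce to statements about a single biased bit.\<close>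

lemma mu_insert:
  assumes "finite A" "i \<notin> A" "0 \<le> p" "p \<le> 1"
  shows "mu (insert i A) p f =
    p * mu A p (\<lambda>x. f (x(i := True))) + (1 - p) * mu A p (\<lambda>x. f (x(i := False)))"
proof -
  have "biased_measure (insert i A) p =
      bind_pmf (bernoulli_pmf p) (\<lambda>b. map_pmf (\<lambda>x. x(i := b)) (biased_measure A p))"
    using assms(1,2) by (simp add: biased_measure_def Pi_pmf_insert' map_pmf_def)
  moreover have "finite (set_pmf (biased_measure A p))"
    using set_biased_measure[OF assms(1)] finite_cube[OF assms(1)] finite_subset by blast
  ultimately show ?thesis
    using assms(3,4) unfolding mu_def
    by (simp only:, subst pmf_expectation_bind[where A = UNIV]) (auto simp: UNIV_bool)
qed

section \<open>Polynomials in the biased characters\<close>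

text \<open>The characters are not normalised, which avoids dividing by \<open>sqrt (p * (1 - p))\<close>.\<close>

definition biased_poly :: "real \<Rightarrow> nat set \<Rightarrow> (nat set \<Rightarrow> real) \<Rightarrow> (nat \<Rightarrow> bool) \<Rightarrow> real" where
  "biased_poly p A c x = (\<Sum>S\<in>Pow A. c S * (\<Prod>i\<in>S. of_bool (x i) - p))"

lemma sum_Pow_insert:
  fixes h :: "'a set \<Rightarrow> 'b::comm_monoid_add"
  assumes "finite A" "i \<notin> A"
  shows "(\<Sum>S\<in>Pow (insert i A). h S) = (\<Sum>S\<in>Pow A. h S) + (\<Sum>S\<in>Pow A. h (insert i S))"
proof -
  have "inj_on (insert i) (Pow A)"
    using assms(2) by (auto simp: inj_on_def)
  moreover have "Pow A \<inter> insert i ` Pow A = {}"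
    using assms(2) by auto
  ultimately show ?thesis
    using assms(1) by (simp add: Pow_insert sum.union_disjoint sum.reindex)
qed

lemma card_insert_Pow: "finite A \<Longrightarrow> i \<notin> A \<Longrightarrow> S \<in> Pow A \<Longrightarrow> card (insert i S) = Suc (card S)"
  by (metis PowD card_insert_disjoint finite_subset subsetD)

lemma biased_poly_insert:
  assumes "finite A" "i \<notin> A"
  shows "biased_poly p (insert i A) c x =
    biased_poly p A c x + (of_bool (x i) - p) * biased_poly p A (\<lambda>S. c (insert i S)) x"
proof -
  have "(\<Prod>j\<in>insert i S. of_bool (x j) - p) = (of_bool (x i) - p) * (\<Prod>j\<in>S. of_bool (x j) - p)"
    if "S \<in> Pow A" for S
    using that assms by (subst prod.insert) (auto intro: finite_subset)
  then have "(\<Sum>S\<in>Pow A. c (insert i S) * (\<Prod>j\<in>insert i S. of_bool (x j) - p)) =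
      (\<Sum>S\<in>Pow A. (of_bool (x i) - p) * (c (insert i S) * (\<Prod>j\<in>S. of_bool (x j) - p)))"
    by (intro sum.cong refl) (simp only: mult_ac)
  then show ?thesis
    unfolding biased_poly_def sum_Pow_insert[OF assms] by (simp only: sum_distrib_left)
qed

lemma biased_poly_cong:
  "(\<And>j. j \<in> A \<Longrightarrow> x j = y j) \<Longrightarrow> biased_poly p A c x = biased_poly p A c y"
  unfolding biased_poly_def by (intro sum.cong refl arg_cong2[where f = "(*)"] prod.cong) auto

lemma biased_poly_upd [simp]:
  "i \<notin> A \<Longrightarrow> biased_poly p A c (x(i := b)) = biased_poly p A c x"
  by (rule biased_poly_cong) auto

lemma biased_poly_add:
  "biased_poly p A (\<lambda>S. a S + b S) x = biased_poly p A a x + biased_poly p A b x"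
  by (simp add: biased_poly_def sum.distrib algebra_simps)

lemma biased_poly_cmult: "biased_poly p A (\<lambda>S. k * c S) x = k * biased_poly p A c x"
  by (simp add: biased_poly_def sum_distrib_left algebra_simps)

text \<open>Interpolation in one coordinate: if \<open>a\<close> and \<open>b\<close> represent the
  restrictions of \<open>f\<close> to \<open>x i = 1\<close> and \<open>x i = 0\<close>, then
  \<open>f = x i * a + (1 - x i) * b = (p * a + (1 - p) * b) + (x i - p) * (a - b)\<close>.\<close>

lemma biased_poly_exists:
  assumes "finite A"
  shows "\<exists>c. \<forall>x\<in>cube A. f x = biased_poly p A c x"
  using assms
proof (induction A arbitrary: f rule: finite_induct)
  case empty
  show ?case
    by (intro exI[of _ "\<lambda>_. f (\<lambda>_. False)"])
       (auto simp: cube_iff biased_poly_def fun_eq_iff intro!: arg_cong[where f = f])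
next
  case (insert i A)
  obtain a where a: "\<forall>x\<in>cube A. f (x(i := True)) = biased_poly p A a x"
    using insert.IH[of "\<lambda>x. f (x(i := True))"] by blast
  obtain b where b: "\<forall>x\<in>cube A. f (x(i := False)) = biased_poly p A b x"
    using insert.IH[of "\<lambda>x. f (x(i := False))"] by blast
  define e where "e S = (if i \<in> S then a (S - {i}) + -1 * b (S - {i}) else p * a S + (1 - p) * b S)" for S
  have "biased_poly p A (\<lambda>S. e (insert i S)) x = biased_poly p A (\<lambda>S. a S + -1 * b S) x" for x
    unfolding biased_poly_def using insert.hyps
    by (intro sum.cong refl) (auto simp: e_def insert_Diff_if Diff_insert_absorb subset_iff
          intro!: arg_cong2[where f = "(-)"] arg_cong[where f = a] arg_cong[where f = b])
  then have e1: "biased_poly p A (\<lambda>S. e (insert i S)) x = biased_poly p A a x + -1 * biased_poly p A b x" for x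
    by (simp only: biased_poly_add biased_poly_cmult)
  have "biased_poly p A e x = biased_poly p A (\<lambda>S. p * a S + (1 - p) * b S) x" for x
    unfolding biased_poly_def using insert.hyps by (intro sum.cong refl) (auto simp: e_def)
  then have e0: "biased_poly p A e x = p * biased_poly p A a x + (1 - p) * biased_poly p A b x" for x
    by (simp only: biased_poly_add biased_poly_cmult)
  have "f x = biased_poly p (insert i A) e x" if x: "x \<in> cube (insert i A)" for x
  proof -
    define y where "y = x(i := False)"
    have y: "y \<in> cube A" using x by (auto simp: y_def cube_iff)
    have "f x = (if x i then f (y(i := True)) else f (y(i := False)))"
      by (auto simp: y_def fun_eq_iff intro!: arg_cong[where f = f])
    also have "\<dots> = (if x i then biased_poly p A a y else biased_poly p A b y)"
      using a b y by auto
    also have "\<dots> = (if x i then biased_poly p A a x else biased_poly p A b x)"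
      using insert.hyps by (simp add: y_def)
    also have "\<dots> = biased_poly p (insert i A) e x"
      using insert.hyps by (simp add: biased_poly_insert e1 e0 algebra_simps)
    finally show ?thesis .
  qed
  then show ?case by blast
qed

text \<open>Under the measure, \<open>x i - p\<close> has mean 0 and variance
  \<open>p * (1 - p)\<close>, so averaging over one coordinate kills the cross terms and multiplies
  the remaining new term by that variance.\<close>

lemma parseval:
  assumes "finite A" "0 \<le> p" "p \<le> 1"
  shows "mu A p (\<lambda>x. biased_poly p A a x * biased_poly p A b x) =
    (\<Sum>S\<in>Pow A. (p * (1 - p)) ^ card S * a S * b S)"
  using assms(1)
proof (induction A arbitrary: a b rule: finite_induct)
  case empty
  show ?case by (simp add: mu_empty biased_poly_def)
next
  case (insert i A)
  let ?F = "biased_poly p A"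
  let ?a = "\<lambda>S. a (insert i S)" and ?b = "\<lambda>S. b (insert i S)"
  have "mu (insert i A) p (\<lambda>x. biased_poly p (insert i A) a x * biased_poly p (insert i A) b x) =
      p * mu A p (\<lambda>x. (?F a x + (1 - p) * ?F ?a x) * (?F b x + (1 - p) * ?F ?b x)) +
      (1 - p) * mu A p (\<lambda>x. (?F a x - p * ?F ?a x) * (?F b x - p * ?F ?b x))"
    using insert.hyps assms by (simp add: mu_insert biased_poly_insert)
  also have "\<dots> = mu A p (\<lambda>x. p * ((?F a x + (1 - p) * ?F ?a x) * (?F b x + (1 - p) * ?F ?b x)) +
      (1 - p) * ((?F a x - p * ?F ?a x) * (?F b x - p * ?F ?b x)))"
    using insert.hyps by (simp only: mu_add mu_cmult)
  also have "\<dots> = mu A p (\<lambda>x. ?F a x * ?F b x + (p * (1 - p)) * (?F ?a x * ?F ?b x))"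
    by (rule arg_cong[where f = "mu A p"]) (rule ext, algebra)
  also have "\<dots> = (\<Sum>S\<in>Pow A. (p * (1 - p)) ^ card S * a S * b S) +
      (p * (1 - p)) * (\<Sum>S\<in>Pow A. (p * (1 - p)) ^ card S * ?a S * ?b S)"
    using insert by (simp only: mu_add mu_cmult)
  also have "\<dots> = (\<Sum>S\<in>Pow (insert i A). (p * (1 - p)) ^ card S * a S * b S)"
    using insert.hyps by (simp add: sum_Pow_insert card_insert_Pow sum_distrib_left mult.assoc)
  finally show ?case .
qed

section \<open>Generalised influences and hypercontractivity\<close>

text \<open>For \<open>w = v = p * (1 - p)\<close> this is \<open>v ^ card S\<close> times the
  generalised influence \<open>E[(D_S f)^2]\<close>, where \<open>D_S\<close> is the iterated
  difference in the coordinates of \<open>S\<close>. Other values of \<open>w\<close> rescale level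
  \<open>k\<close> by \<open>(w / v) ^ k\<close>.\<close>

definition upper_weight :: "real \<Rightarrow> nat set \<Rightarrow> (nat set \<Rightarrow> real) \<Rightarrow> nat set \<Rightarrow> real" where
  "upper_weight w A c S = (\<Sum>T\<in>Pow A. if S \<subseteq> T then w ^ card T * (c T)\<^sup>2 else 0)"

lemma upper_weight_insert:
  assumes "finite A" "i \<notin> A" "S \<subseteq> A"
  shows "upper_weight w (insert i A) c S =
      upper_weight w A c S + w * upper_weight w A (\<lambda>S. c (insert i S)) S"
    and "upper_weight w (insert i A) c (insert i S) = w * upper_weight w A (\<lambda>S. c (insert i S)) S"
proof -
  have 1: "S \<subseteq> insert i T \<longleftrightarrow> S \<subseteq> T" for T
    using assms by auto
  have 2: "\<not> insert i S \<subseteq> T" if "T \<in> Pow A" for T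
    using that assms by auto
  have 3: "(\<Sum>T\<in>Pow A. if S \<subseteq> T then w ^ card (insert i T) * (c (insert i T))\<^sup>2 else 0)
      = w * upper_weight w A (\<lambda>S. c (insert i S)) S"
    unfolding upper_weight_def sum_distrib_left
    by (intro sum.cong refl) (simp add: card_insert_Pow[OF assms(1,2)])
  show "upper_weight w (insert i A) c S =
      upper_weight w A c S + w * upper_weight w A (\<lambda>S. c (insert i S)) S"
    unfolding 3[symmetric] using assms by (simp add: upper_weight_def sum_Pow_insert 1)
  have "(\<Sum>T\<in>Pow A. if insert i S \<subseteq> T then w ^ card T * (c T)\<^sup>2 else 0) = 0"
    using 2 by (intro sum.neutral) auto
  then show "upper_weight w (insert i A) c (insert i S) = w * upper_weight w A (\<lambda>S. c (insert i S)) S"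
    unfolding 3[symmetric] using assms by (simp add: upper_weight_def sum_Pow_insert 1)
qed

text \<open>The left side is \<open>E[(a + X * b)^2 * (c + X * d)^2]\<close> for a centred biased
  bit \<open>X\<close>, whose moments from the first to the fourth are 0, \<open>v\<close>,
  \<open>v * (1 - 2 * p)\<close> and \<open>v * ((1 - p)^3 + p^3)\<close>. The last is of order
  \<open>v\<close>, not \<open>v^2\<close>, for small \<open>p\<close>; hence the coefficient
  \<open>3 * v\<close>.\<close>

lemma two_point_fourth_moment:
  fixes p a b c d :: real
  assumes "0 \<le> p" "p \<le> 1"
  defines "v \<equiv> p * (1 - p)"
  shows "p * ((a + (1 - p) * b)\<^sup>2 * (c + (1 - p) * d)\<^sup>2) + (1 - p) * ((a - p * b)\<^sup>2 * (c - p * d)\<^sup>2)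
    \<le> a\<^sup>2 * c\<^sup>2 + 4 * v * (a\<^sup>2 * d\<^sup>2 + b\<^sup>2 * c\<^sup>2) + 3 * v * (b\<^sup>2 * d\<^sup>2)"
proof -
  have v: "0 \<le> v" using assms by simp
  have eq: "p * ((a + (1 - p) * b)\<^sup>2 * (c + (1 - p) * d)\<^sup>2) + (1 - p) * ((a - p * b)\<^sup>2 * (c - p * d)\<^sup>2)
    = a\<^sup>2 * c\<^sup>2 + v * (a\<^sup>2 * d\<^sup>2 + b\<^sup>2 * c\<^sup>2 + 4 * (a * d) * (b * c)
        + (1 - 2 * p) * (2 * (a * d) * (b * d) + 2 * (b * c) * (b * d))
        + ((1 - p) ^ 3 + p ^ 3) * (b\<^sup>2 * d\<^sup>2))"
    unfolding v_def by (simp add: algebra_simps power2_eq_square power3_eq_cube)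
  have h1: "2 * \<bar>x * y\<bar> \<le> x\<^sup>2 + y\<^sup>2" for x y :: real
    using sum_squares_bound[of "\<bar>x\<bar>" "\<bar>y\<bar>"] by (simp add: abs_mult)
  have s: "\<bar>1 - 2 * p\<bar> \<le> 1" using assms by linarith
  have h2: "(1 - 2 * p) * (2 * x * y) \<le> x\<^sup>2 + y\<^sup>2" for x y :: real
  proof -
    have "(1 - 2 * p) * (2 * x * y) \<le> \<bar>1 - 2 * p\<bar> * (2 * \<bar>x * y\<bar>)"
      using abs_ge_self[of "(1 - 2 * p) * (2 * x * y)"] by (simp add: abs_mult mult.assoc)
    also have "\<dots> \<le> 1 * (2 * \<bar>x * y\<bar>)" by (intro mult_right_mono s) auto
    finally show ?thesis using h1[of x y] by simp
  qed
  have "(1 - p) ^ 3 \<le> 1 - p" "p ^ 3 \<le> p"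
    using power_decreasing[of 1 3 "1 - p"] power_decreasing[of 1 3 p] assms by auto
  then have h3: "((1 - p) ^ 3 + p ^ 3) * (b\<^sup>2 * d\<^sup>2) \<le> 1 * (b\<^sup>2 * d\<^sup>2)"
    by (intro mult_right_mono) auto
  have h4: "2 * (a * d) * (b * c) \<le> (a * d)\<^sup>2 + (b * c)\<^sup>2"
    by (rule sum_squares_bound)
  have "v * (a\<^sup>2 * d\<^sup>2 + b\<^sup>2 * c\<^sup>2 + 4 * (a * d) * (b * c)
        + (1 - 2 * p) * (2 * (a * d) * (b * d) + 2 * (b * c) * (b * d))
        + ((1 - p) ^ 3 + p ^ 3) * (b\<^sup>2 * d\<^sup>2))
    \<le> v * (4 * (a\<^sup>2 * d\<^sup>2 + b\<^sup>2 * c\<^sup>2) + 3 * (b\<^sup>2 * d\<^sup>2))"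
    using h2[of "a * d" "b * d"] h2[of "b * c" "b * d"] h3 h4
    by (intro mult_left_mono v) (simp add: power_mult_distrib algebra_simps)
  then show ?thesis unfolding eq by (simp add: algebra_simps)
qed

text \<open>Two functions are needed for the induction: splitting off a coordinate from a fourth moment
  produces cross terms \<open>E[a\<^sup>2 * b\<^sup>2]\<close>, for which Cauchy-Schwarz would lose too much.\<close>

lemma global_hypercontractivity:
  assumes "finite A" "0 < p" "p < 1"
  defines "v \<equiv> p * (1 - p)"
  shows "mu A p (\<lambda>x. (biased_poly p A a x)\<^sup>2 * (biased_poly p A b x)\<^sup>2)
    \<le> (\<Sum>S\<in>Pow A. inverse v ^ card S * (upper_weight (4 * v) A a S * upper_weight (4 * v) A b S))"
  using assms(1)
proof (induction A arbitrary: a b rule: finite_induct)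
  case empty
  show ?case by (simp add: mu_empty biased_poly_def upper_weight_def)
next
  case (insert i A)
  let ?F = "biased_poly p A" and ?W = "upper_weight (4 * v) A"
  let ?a = "\<lambda>S. a (insert i S)" and ?b = "\<lambda>S. b (insert i S)"
  let ?E = "\<lambda>a b. \<Sum>S\<in>Pow A. inverse v ^ card S * (?W a S * ?W b S)"
  have v: "0 < v" using assms by simp
  have nonneg: "0 \<le> ?E a b" for a b
    using v by (intro sum_nonneg mult_nonneg_nonneg) (auto simp: upper_weight_def intro!: sum_nonneg)
  have "mu (insert i A) p (\<lambda>x. (biased_poly p (insert i A) a x)\<^sup>2 * (biased_poly p (insert i A) b x)\<^sup>2) =
      p * mu A p (\<lambda>x. (?F a x + (1 - p) * ?F ?a x)\<^sup>2 * (?F b x + (1 - p) * ?F ?b x)\<^sup>2) +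
      (1 - p) * mu A p (\<lambda>x. (?F a x - p * ?F ?a x)\<^sup>2 * (?F b x - p * ?F ?b x)\<^sup>2)"
    using insert.hyps assms by (simp add: mu_insert biased_poly_insert)
  also have "\<dots> = mu A p (\<lambda>x. p * ((?F a x + (1 - p) * ?F ?a x)\<^sup>2 * (?F b x + (1 - p) * ?F ?b x)\<^sup>2) +
      (1 - p) * ((?F a x - p * ?F ?a x)\<^sup>2 * (?F b x - p * ?F ?b x)\<^sup>2))"
    using insert.hyps by (simp only: mu_add mu_cmult)
  also have "\<dots> \<le> mu A p (\<lambda>x. (?F a x)\<^sup>2 * (?F b x)\<^sup>2 +
      4 * v * ((?F a x)\<^sup>2 * (?F ?b x)\<^sup>2 + (?F ?a x)\<^sup>2 * (?F b x)\<^sup>2) + 3 * v * ((?F ?a x)\<^sup>2 * (?F ?b x)\<^sup>2))"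
    unfolding v_def using assms insert.hyps by (intro mu_mono two_point_fourth_moment) auto
  also have "\<dots> = mu A p (\<lambda>x. (?F a x)\<^sup>2 * (?F b x)\<^sup>2) +
      4 * v * (mu A p (\<lambda>x. (?F a x)\<^sup>2 * (?F ?b x)\<^sup>2) + mu A p (\<lambda>x. (?F ?a x)\<^sup>2 * (?F b x)\<^sup>2)) +
      3 * v * mu A p (\<lambda>x. (?F ?a x)\<^sup>2 * (?F ?b x)\<^sup>2)"
    using insert.hyps by (simp only: mu_add mu_cmult)
  also have "\<dots> \<le> ?E a b + 4 * v * (?E a ?b + ?E ?a b) + 3 * v * ?E ?a ?b"
    using v by (intro add_mono mult_left_mono insert.IH) auto
  \<comment> \<open>The enlarged coefficient makes the sum factor: \<open>16 * v^2\<close> completes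
    the product of the two upper weights at a set \<open>S\<close> avoiding \<open>i\<close>, and
    \<open>16 * v = (4 * v)^2 / v\<close> is the term of \<open>insert i S\<close>.\<close>
  also have "\<dots> \<le> ?E a b + 4 * v * (?E a ?b + ?E ?a b) + (16 * v\<^sup>2 + 16 * v) * ?E ?a ?b"
    using v nonneg[of ?a ?b] by (intro add_left_mono mult_right_mono) auto
  also have "\<dots> = (\<Sum>S\<in>Pow A. inverse v ^ card S * ((?W a S + 4 * v * ?W ?a S) * (?W b S + 4 * v * ?W ?b S))) +
      (\<Sum>S\<in>Pow A. inverse v ^ Suc (card S) * ((4 * v * ?W ?a S) * (4 * v * ?W ?b S)))"
    unfolding sum_distrib_left sum.distrib[symmetric] using v
    by (intro sum.cong refl) (simp add: field_simps power2_eq_square)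
  also have "\<dots> = (\<Sum>S\<in>Pow (insert i A). inverse v ^ card S *
      (upper_weight (4 * v) (insert i A) a S * upper_weight (4 * v) (insert i A) b S))"
    unfolding sum_Pow_insert[OF insert.hyps]
    by (intro arg_cong2[where f = "(+)"] sum.cong refl)
       (auto simp: upper_weight_insert[OF insert.hyps] card_insert_Pow[OF insert.hyps])
  finally show ?case .
qed

section \<open>Influences bounded by a pointwise majorant\<close>

text \<open>The iterated difference over \<open>S\<close> is a signed sum of
  \<open>2 ^ card S\<close> values, each at most \<open>G\<close> in absolute value; squaring gives
  \<open>4 ^ card S\<close>. The induction takes one difference at a time, doubling
  \<open>G\<close>, and ends with Parseval.\<close>

lemma upper_weight_bound:
  assumes "finite A" "finite S" "A \<inter> S = {}" "0 \<le> p" "p \<le> 1"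
    and "\<And>x z. x \<in> cube A \<Longrightarrow> (\<And>j. j \<in> A \<Longrightarrow> z j = x j) \<Longrightarrow> \<bar>biased_poly p (A \<union> S) c z\<bar> \<le> G x"
  shows "upper_weight (p * (1 - p)) (A \<union> S) c S \<le> (4 * (p * (1 - p))) ^ card S * mu A p (\<lambda>x. (G x)\<^sup>2)"
  using assms(2,3,6)
proof (induction S arbitrary: c G rule: finite_induct)
  case empty
  have "upper_weight (p * (1 - p)) A c {} = mu A p (\<lambda>x. (biased_poly p A c x)\<^sup>2)"
    using parseval[OF assms(1,4,5), of c c]
    by (simp add: upper_weight_def power2_eq_square algebra_simps)
  also have "\<dots> \<le> mu A p (\<lambda>x. (G x)\<^sup>2)"
  proof (rule mu_mono)
    fix x assume x: "x \<in> cube A"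
    have "\<bar>biased_poly p A c x\<bar> \<le> G x"
      using empty.prems(2)[OF x refl] by simp
    then show "(biased_poly p A c x)\<^sup>2 \<le> (G x)\<^sup>2"
      by (metis abs_ge_zero power2_abs power_mono)
  qed (rule assms(1))
  finally show ?case by simp
next
  case (insert i S)
  let ?c = "\<lambda>T. c (insert i T)"
  have iA: "i \<notin> A" "i \<notin> A \<union> S" "finite (A \<union> S)" using insert assms(1) by auto
  have "upper_weight (p * (1 - p)) (A \<union> S) ?c S
      \<le> (4 * (p * (1 - p))) ^ card S * mu A p (\<lambda>x. (2 * G x)\<^sup>2)"
  proof (rule insert.IH)
    show "A \<inter> S = {}" using insert.prems by auto
    fix x z assume x: "x \<in> cube A" and z: "\<And>j. j \<in> A \<Longrightarrow> z j = x j"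
    \<comment> \<open>The coefficients \<open>c (insert i T)\<close> are those of the difference in
      direction \<open>i\<close>.\<close>
    have "biased_poly p (A \<union> S) ?c z =
        biased_poly p (A \<union> insert i S) c (z(i := True)) - biased_poly p (A \<union> insert i S) c (z(i := False))"
      using iA(2) by (simp add: biased_poly_insert[OF iA(3,2)] left_diff_distrib)
    moreover have "\<bar>biased_poly p (A \<union> insert i S) c (z(i := b))\<bar> \<le> G x" for b
      using z iA(1) by (intro insert.prems(2)[OF x]) auto
    from this[of True] this[of False]
    have "\<bar>biased_poly p (A \<union> insert i S) c (z(i := True)) - biased_poly p (A \<union> insert i S) c (z(i := False))\<bar>
        \<le> 2 * G x" by linarith
    ultimately show "\<bar>biased_poly p (A \<union> S) ?c z\<bar> \<le> 2 * G x" by simp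
  qed
  then have "p * (1 - p) * upper_weight (p * (1 - p)) (A \<union> S) ?c S
      \<le> p * (1 - p) * ((4 * (p * (1 - p))) ^ card S * mu A p (\<lambda>x. (2 * G x)\<^sup>2))"
    using assms by (intro mult_left_mono) auto
  also have "\<dots> = (4 * (p * (1 - p))) ^ card (insert i S) * mu A p (\<lambda>x. (G x)\<^sup>2)"
    using insert.hyps assms(1) by (simp add: power_mult_distrib mu_cmult)
  finally show ?case
    using upper_weight_insert(2)[OF iA(3,2), of S] by simp
qed

section \<open>One-sided noise from the monotone coupling\<close>

text \<open>The coefficients \<open>(p / q) ^ card S * c S\<close> are those of \<open>y \<mapsto> E[f x | y]\<close> for the coupling
  \<open>x \<le> y\<close> of the two biased measures.\<close>

lemma mu_le_one_sided_noise:
  assumes "finite A" "0 \<le> p" "p \<le> q" "0 < q" "q \<le> 1"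
    and "\<And>x y. x \<in> cube A \<Longrightarrow> y \<in> cube A \<Longrightarrow> x \<le> y \<Longrightarrow> h x \<le> biased_poly p A c x * g y"
  shows "mu A p h \<le> mu A q (\<lambda>y. g y * biased_poly q A (\<lambda>S. (p / q) ^ card S * c S) y)"
  using assms(1,6)
proof (induction A arbitrary: h c g rule: finite_induct)
  case empty
  show ?case
    using empty[of "\<lambda>_. False" "\<lambda>_. False"]
    by (simp add: mu_empty biased_poly_def cube_iff mult.commute)
next
  case (insert i A)
  define T where "T c = biased_poly q A (\<lambda>S. (p / q) ^ card S * c S)" for c
  let ?c = "\<lambda>S. c (insert i S)"
  define c1 where "c1 S = c S + (1 - p) * ?c S" for S
  define c0 where "c0 S = c S + (- p) * ?c S" for S
  have T1: "T c1 y = T c y + (1 - p) * T ?c y" for y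
    by (simp add: T_def c1_def biased_poly_def sum_distrib_left algebra_simps
        flip: sum.distrib sum_subtractf)
  have T0: "T c0 y = T c y - p * T ?c y" for y
    by (simp add: T_def c0_def biased_poly_def sum_distrib_left algebra_simps
        flip: sum.distrib sum_subtractf)
  \<comment> \<open>Because the hypothesis concerns pairs \<open>x \<le> y\<close>, it survives
    fixing \<open>x i\<close> and \<open>y i\<close> to different values, as long as
    \<open>b \<le> b'\<close>.\<close>
  have prem: "h (x(i := b)) \<le> biased_poly p (insert i A) c (x(i := b)) * g (y(i := b'))"
    if "x \<in> cube A" "y \<in> cube A" "x \<le> y" "b \<le> b'" for x y b b'
    by (rule insert.prems) (use that in \<open>auto simp: cube_iff le_fun_def\<close>)
  have P: "biased_poly p (insert i A) c (x(i := True)) = biased_poly p A c1 x"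
      "biased_poly p (insert i A) c (x(i := False)) = biased_poly p A c0 x" for x
    unfolding c1_def c0_def biased_poly_add biased_poly_cmult
    using insert.hyps by (simp_all add: biased_poly_insert)
  have T_insert: "biased_poly q (insert i A) (\<lambda>S. (p / q) ^ card S * c S) y =
      T c y + (of_bool (y i) - q) * (p / q * T ?c y)" for y
  proof -
    have "biased_poly q A (\<lambda>S. (p / q) ^ card (insert i S) * ?c S) y =
        biased_poly q A (\<lambda>S. p / q * ((p / q) ^ card S * ?c S)) y"
      unfolding biased_poly_def
      by (intro sum.cong refl) (simp add: card_insert_Pow[OF insert.hyps(1,2)])
    then show ?thesis
      unfolding T_def biased_poly_insert[OF insert.hyps(1,2)] by (simp only: biased_poly_cmult)
  qed
  have Tupd: "T c (y(i := b)) = T c y" for c y b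
    using insert.hyps by (simp add: T_def)
  \<comment> \<open>The three bounds treat the possible values (1, 1), (0, 1) and (0, 0) of
    \<open>(x i, y i)\<close>, which the coupling takes with probabilities \<open>p\<close>,
    \<open>q - p\<close> and \<open>1 - q\<close>.\<close>
  have le1: "mu A p (\<lambda>x. h (x(i := True))) \<le> mu A q (\<lambda>y. g (y(i := True)) * T c1 y)"
    unfolding T_def
    by (rule insert.IH, unfold P[symmetric], rule prem) simp_all
  have le2: "mu A p (\<lambda>x. h (x(i := False))) \<le> mu A q (\<lambda>y. g (y(i := True)) * T c0 y)"
    unfolding T_def
    by (rule insert.IH, unfold P[symmetric], rule prem) simp_all
  have le3: "mu A p (\<lambda>x. h (x(i := False))) \<le> mu A q (\<lambda>y. g (y(i := False)) * T c0 y)"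
    unfolding T_def
    by (rule insert.IH, unfold P[symmetric], rule prem) simp_all
  have "mu (insert i A) p h =
      p * mu A p (\<lambda>x. h (x(i := True))) + (q - p) * mu A p (\<lambda>x. h (x(i := False)))
      + (1 - q) * mu A p (\<lambda>x. h (x(i := False)))"
    using insert.hyps assms by (simp add: mu_insert algebra_simps)
  also have "\<dots> \<le> p * mu A q (\<lambda>y. g (y(i := True)) * T c1 y)
      + (q - p) * mu A q (\<lambda>y. g (y(i := True)) * T c0 y)
      + (1 - q) * mu A q (\<lambda>y. g (y(i := False)) * T c0 y)"
    using le1 le2 le3 assms by (intro add_mono mult_left_mono) auto
  also have "\<dots> = mu A q (\<lambda>y. p * (g (y(i := True)) * T c1 y) + (q - p) * (g (y(i := True)) * T c0 y)
      + (1 - q) * (g (y(i := False)) * T c0 y))"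
    using insert.hyps by (simp only: mu_add mu_cmult)
  \<comment> \<open>Regrouping by the value of \<open>y i\<close>; the coefficient of
    \<open>T ?c\<close> for \<open>y i = 1\<close> is
    \<open>p * (1 - p) - (q - p) * p = q * (1 - q) * (p / q)\<close>.\<close>
  also have "\<dots> = mu A q (\<lambda>y. q * (g (y(i := True)) * (T c y + (1 - q) * (p / q * T ?c y)))
      + (1 - q) * (g (y(i := False)) * (T c y + (0 - q) * (p / q * T ?c y))))"
    by (rule arg_cong[where f = "mu A q"]) (use assms(4) in \<open>auto simp: T1 T0 field_simps\<close>)
  also have "\<dots> = q * mu A q (\<lambda>y. g (y(i := True)) * (T c y + (1 - q) * (p / q * T ?c y)))
      + (1 - q) * mu A q (\<lambda>y. g (y(i := False)) * (T c y + (0 - q) * (p / q * T ?c y)))"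
    using insert.hyps by (simp only: mu_add mu_cmult)
  also have "\<dots> = mu (insert i A) q (\<lambda>y. g y * biased_poly q (insert i A) (\<lambda>S. (p / q) ^ card S * c S) y)"
    using insert.hyps assms by (simp add: mu_insert T_insert Tupd)
  finally show ?case .
qed

section \<open>The level-d inequality for global functions\<close>

text \<open>Double counting: each \<open>T\<close> has \<open>2 ^ card T\<close> subsets
  \<open>S\<close>.\<close>

lemma sum_upper_weight:
  assumes "finite A"
  shows "(\<Sum>S\<in>Pow A. upper_weight w A c S) = (\<Sum>T\<in>Pow A. 2 ^ card T * (w ^ card T * (c T)\<^sup>2))"
proof -
  have "(\<Sum>S\<in>Pow A. if S \<subseteq> T then k else 0) = 2 ^ card T * k" if "T \<in> Pow A" for T and k :: real
  proof -
    have "{S \<in> Pow A. S \<subseteq> T} = Pow T" using that by auto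
    moreover have "finite T" using that assms by (auto intro: finite_subset)
    ultimately show ?thesis
      using assms by (simp add: sum.inter_filter[symmetric] card_Pow)
  qed
  then show ?thesis
    unfolding upper_weight_def by (subst sum.swap) (intro sum.cong refl, simp)
qed

lemma upper_weight_mono:
  assumes "\<And>T. T \<subseteq> A \<Longrightarrow> w ^ card T * (a T)\<^sup>2 \<le> k * (u ^ card T * (b T)\<^sup>2)"
  shows "upper_weight w A a S \<le> k * upper_weight u A b S"
  unfolding upper_weight_def sum_distrib_left by (intro sum_mono) (auto intro: assms)

lemma upper_weight_nonneg: "0 \<le> w \<Longrightarrow> 0 \<le> upper_weight w A c S"
  by (auto simp: upper_weight_def intro!: sum_nonneg)

definition low_degree_part :: "nat \<Rightarrow> (nat set \<Rightarrow> real) \<Rightarrow> nat set \<Rightarrow> real" where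
  "low_degree_part d c S = (if card S \<le> d then c S else 0)"

text \<open>With \<open>g\<close> the low-degree part, \<open>W = E[f * g]\<close> and Hoelder gives
  \<open>W^4 \<le> (\<mu>_p f)^3 * E[g^4]\<close>, while hypercontractivity and the influence bounds
  give \<open>E[g^4] \<le> 128 ^ d * \<eta> * W\<close>. Here 128 is 64 from the term-wise bound
  times 2 from summing the upper weights.\<close>

lemma level_d_inequality:
  assumes fin: "finite A" and p: "0 < p" "p < 1"
    and f01: "\<And>x. x \<in> cube A \<Longrightarrow> f x \<in> {0, 1}" and mono: "mono_on (cube A) f"
    and f: "\<And>x. x \<in> cube A \<Longrightarrow> f x = biased_poly p A c x"
    and \<eta>: "\<And>J. J \<subseteq> A \<Longrightarrow> card J \<le> d \<Longrightarrow> mu (A - J) p (restrict_to_one f J) \<le> \<eta>"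
  defines "v \<equiv> p * (1 - p)"
  defines "W \<equiv> \<Sum>S\<in>Pow A. v ^ card S * (low_degree_part d c S)\<^sup>2"
  shows "W ^ 3 \<le> 128 ^ d * \<eta> * (mu A p f) ^ 3"
proof -
  define b where "b = low_degree_part d c"
  define g where "g = biased_poly p A b"
  define m where "m = mu A p f"
  let ?U = "upper_weight v A b" and ?V = "upper_weight (4 * v) A b"
  have v: "0 < v" using p by (simp add: v_def)
  have f_sq: "(f x)\<^sup>2 = f x" if "x \<in> cube A" for x
    using f01[OF that] by auto
  have m: "0 \<le> m"
    unfolding m_def using f01 by (intro mu_nonneg[OF fin]) force
  have eta: "0 \<le> \<eta>"
    using \<eta>[of "{}"] m by (simp add: restrict_to_one_def m_def)
  have W: "0 \<le> W"
    unfolding W_def using v by (intro sum_nonneg) simp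
  have W_eq: "W = mu A p (\<lambda>x. f x * g x)"
  proof -
    have "W = (\<Sum>S\<in>Pow A. v ^ card S * c S * b S)"
      unfolding W_def b_def by (intro sum.cong refl) (simp add: low_degree_part_def power2_eq_square)
    also have "\<dots> = mu A p (\<lambda>x. biased_poly p A c x * g x)"
      unfolding g_def v_def using parseval[OF fin, of p c b] p by simp
    finally show ?thesis
      using f by (simp cong: mu_cong[OF fin])
  qed

  \<comment> \<open>Globalness enters here: by monotonicity every restriction of \<open>f\<close> on
    \<open>S\<close> lies between 0 and \<open>f\<close> with \<open>S\<close> set to 1, so the
    latter serves as the majorant \<open>G\<close>. Truncation only decreases upper weights.\<close>
  have U_le: "?U S \<le> (4 * v) ^ card S * \<eta>" if S: "S \<subseteq> A" "card S \<le> d" for S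
  proof -
    have cube_S: "(\<lambda>i. if i \<in> S then True else x i) \<in> cube A" if "x \<in> cube (A - S)" for x
      using that S by (auto simp: cube_iff)
    have "?U S \<le> 1 * upper_weight v A c S"
      using v by (intro upper_weight_mono) (auto simp: b_def low_degree_part_def)
    also have "\<dots> \<le> (4 * v) ^ card S * mu (A - S) p (\<lambda>x. (restrict_to_one f S x)\<^sup>2)"
    proof -
      have "upper_weight (p * (1 - p)) ((A - S) \<union> S) c S
          \<le> (4 * (p * (1 - p))) ^ card S * mu (A - S) p (\<lambda>x. (restrict_to_one f S x)\<^sup>2)"
      proof (rule upper_weight_bound)
        fix x z assume x: "x \<in> cube (A - S)" and z: "\<And>j. j \<in> A - S \<Longrightarrow> z j = x j"
        \<comment> \<open>The point \<open>z\<close> is arbitrary off \<open>A\<close>; clearing it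
          there lands in the cube and leaves the polynomial unchanged.\<close>
        define y where "y = (\<lambda>j. j \<in> A \<and> z j)"
        have y: "y \<in> cube A" by (auto simp: y_def cube_iff)
        have "A - S \<union> S = A" using S by auto
        then have "biased_poly p (A - S \<union> S) c z = f y"
          unfolding f[OF y] by (auto simp: y_def intro!: biased_poly_cong)
        moreover have "f y \<le> restrict_to_one f S x"
          unfolding restrict_to_one_def
          by (rule mono_onD[OF mono y cube_S[OF x]]) (use z in \<open>auto simp: y_def le_fun_def\<close>)
        moreover have "0 \<le> f y" using f01[OF y] by auto
        ultimately show "\<bar>biased_poly p (A - S \<union> S) c z\<bar> \<le> restrict_to_one f S x" by simp
      qed (use fin p S in \<open>auto intro: finite_subset\<close>)
      moreover have "A - S \<union> S = A" using S by auto
      ultimately show ?thesis by (simp add: v_def)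
    qed
    also have "mu (A - S) p (\<lambda>x. (restrict_to_one f S x)\<^sup>2) = mu (A - S) p (restrict_to_one f S)"
      using fin cube_S by (intro mu_cong) (auto simp: restrict_to_one_def f_sq)
    also have "(4 * v) ^ card S * mu (A - S) p (restrict_to_one f S) \<le> (4 * v) ^ card S * \<eta>"
      using v \<eta>[OF S] by (intro mult_left_mono) auto
    finally show ?thesis .
  qed

  have V_le: "?V S \<le> 4 ^ d * ?U S" for S
  proof (rule upper_weight_mono)
    fix T assume "T \<subseteq> A"
    show "(4 * v) ^ card T * (b T)\<^sup>2 \<le> 4 ^ d * (v ^ card T * (b T)\<^sup>2)"
    proof (cases "card T \<le> d")
      case True
      then have "(4::real) ^ card T \<le> 4 ^ d" by (intro power_increasing) auto
      then have "4 ^ card T * (v ^ card T * (b T)\<^sup>2) \<le> 4 ^ d * (v ^ card T * (b T)\<^sup>2)"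
        using v by (intro mult_right_mono) auto
      then show ?thesis by (simp add: power_mult_distrib mult.assoc)
    qed (simp add: b_def low_degree_part_def)
  qed

  \<comment> \<open>One factor \<open>?V S\<close> is bounded through \<open>U_le\<close>, which
    cancels \<open>inverse v ^ card S\<close>; the other is kept, so that the sum over
    \<open>S\<close> is linear in \<open>W\<close>. The 64 is 4 * 4 from \<open>V_le\<close> and 4
    from \<open>U_le\<close>. If \<open>card S > d\<close>, no set of the low-degree part contains
    \<open>S\<close>.\<close>
  have term_le: "inverse v ^ card S * (?V S * ?V S) \<le> 64 ^ d * \<eta> * ?U S" if S: "S \<in> Pow A" for S
  proof (cases "card S \<le> d")
    case True
    have U0: "0 \<le> ?U S" and V0: "0 \<le> ?V S" using v by (simp_all add: upper_weight_nonneg)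
    have "inverse v ^ card S * (?V S * ?V S) \<le> inverse v ^ card S * ((4 ^ d * ?U S) * (4 ^ d * ?U S))"
      using v V_le U0 V0 by (intro mult_left_mono mult_mono) auto
    also have "\<dots> \<le> inverse v ^ card S * ((4 ^ d * ((4 * v) ^ card S * \<eta>)) * (4 ^ d * ?U S))"
      using v U_le[of S] S True U0 by (intro mult_left_mono mult_right_mono) auto
    also have "\<dots> = 4 ^ card S * (16 ^ d * \<eta> * ?U S)"
      using v by (simp add: power_mult_distrib power_inverse field_simps flip: power_mult_distrib[of 4 4])
    also have "\<dots> \<le> 4 ^ d * (16 ^ d * \<eta> * ?U S)"
      using True U0 eta by (intro mult_right_mono power_increasing) auto
    also have "\<dots> = 64 ^ d * \<eta> * ?U S"
      by (simp add: mult.assoc[symmetric] flip: power_mult_distrib)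
    finally show ?thesis .
  next
    case False
    have "b T = 0" if "T \<in> Pow A" "S \<subseteq> T" for T
      using False card_mono[of T S] finite_subset[of T A] fin that by (auto simp: b_def low_degree_part_def)
    then have "?V S = 0"
      unfolding upper_weight_def by (intro sum.neutral) auto
    then show ?thesis using v eta by (simp add: upper_weight_nonneg)
  qed

  have "mu A p (\<lambda>x. (g x)\<^sup>2 * (g x)\<^sup>2) \<le> (\<Sum>S\<in>Pow A. inverse v ^ card S * (?V S * ?V S))"
    unfolding g_def v_def by (rule global_hypercontractivity[OF fin p])
  also have "\<dots> \<le> 64 ^ d * \<eta> * (\<Sum>S\<in>Pow A. ?U S)"
    unfolding sum_distrib_left by (intro sum_mono term_le)
  also have "(\<Sum>S\<in>Pow A. ?U S) \<le> 2 ^ d * W"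
    unfolding sum_upper_weight[OF fin] W_def sum_distrib_left b_def[symmetric]
  proof (intro sum_mono)
    fix T
    show "2 ^ card T * (v ^ card T * (b T)\<^sup>2) \<le> 2 ^ d * (v ^ card T * (b T)\<^sup>2)"
      using v by (cases "card T \<le> d")
        (auto simp: b_def low_degree_part_def intro!: mult_right_mono power_increasing)
  qed
  finally have g4: "mu A p (\<lambda>x. (g x)\<^sup>2 * (g x)\<^sup>2) \<le> 64 ^ d * \<eta> * (2 ^ d * W)"
    using eta by (simp add: mult_left_mono)
  also have "\<dots> = (64 * 2) ^ d * \<eta> * W"
    unfolding power_mult_distrib by simp
  finally have g4: "mu A p (\<lambda>x. (g x)\<^sup>2 * (g x)\<^sup>2) \<le> 128 ^ d * \<eta> * W"
    by simp

  txt \<open>Hoelder's inequality with exponents 4/3 and 4, as two applications of Cauchy-Schwarz.\<close>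
  define R where "R = mu A p (\<lambda>x. f x * (g x)\<^sup>2)"
  have "W\<^sup>2 = (mu A p (\<lambda>x. f x * (f x * g x)))\<^sup>2"
    unfolding W_eq by (intro arg_cong[where f = "\<lambda>t. t\<^sup>2"] mu_cong[OF fin])
      (simp add: f_sq mult.assoc[symmetric] flip: power2_eq_square)
  also have "\<dots> \<le> mu A p (\<lambda>x. (f x)\<^sup>2) * mu A p (\<lambda>x. (f x * g x)\<^sup>2)"
    by (rule mu_Cauchy_Schwarz[OF fin])
  also have "\<dots> = m * R"
    unfolding m_def R_def by (intro arg_cong2[where f = "(*)"] mu_cong[OF fin]) (simp_all add: f_sq power_mult_distrib)
  finally have 1: "W\<^sup>2 \<le> m * R" .
  have "R\<^sup>2 \<le> mu A p (\<lambda>x. (f x)\<^sup>2) * mu A p (\<lambda>x. ((g x)\<^sup>2)\<^sup>2)"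
    unfolding R_def by (rule mu_Cauchy_Schwarz[OF fin])
  also have "mu A p (\<lambda>x. (f x)\<^sup>2) = m"
    unfolding m_def by (intro mu_cong[OF fin] f_sq)
  also have "m * mu A p (\<lambda>x. ((g x)\<^sup>2)\<^sup>2) \<le> m * (128 ^ d * \<eta> * W)"
    using g4 m by (intro mult_left_mono) (simp_all add: power2_eq_square)
  finally have 2: "R\<^sup>2 \<le> m * (128 ^ d * \<eta> * W)" .
  have "(W\<^sup>2)\<^sup>2 \<le> (m * R)\<^sup>2"
    using 1 by (intro power_mono) auto
  also have "\<dots> \<le> m\<^sup>2 * (m * (128 ^ d * \<eta> * W))"
    unfolding power_mult_distrib using 2 by (intro mult_left_mono) auto
  \<comment> \<open>The fourth-moment bound contains a factor \<open>W\<close>; cancelling it leaves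
    the cube.\<close>
  finally have "W * W ^ 3 \<le> W * (128 ^ d * \<eta> * m ^ 3)"
    by (simp add: power2_eq_square power3_eq_cube mult_ac)
  then have "W ^ 3 \<le> 128 ^ d * \<eta> * m ^ 3" if "W \<noteq> 0"
    using that W by (simp add: mult_le_cancel_left)
  then show ?thesis
    using eta m by (cases "W = 0") (auto simp: m_def)
qed

section \<open>Comparing the two biases by splitting at level d\<close>

text \<open>Split \<open>T f\<close> in \<open>\<mu>_p f \<le> E_q[f * T f]\<close> at level
  \<open>d\<close> and apply Cauchy-Schwarz to both halves. Squared norms shrink by
  \<open>\<theta> ^ k\<close> on level \<open>k\<close>, so the low half has squared norm at most
  \<open>W\<close> and the high half at most \<open>\<theta> ^ d\<close> times the total weight
  \<open>E_p[f^2] = \<mu>_p f\<close>.\<close>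

lemma mu_le_low_degree_and_noise:
  fixes d :: nat
  assumes fin: "finite A" and p: "0 < p" "p \<le> q" "q < 1" and \<theta>: "p \<le> \<theta> * q" "0 \<le> \<theta>" "\<theta> \<le> 1"
    and f01: "\<And>x. x \<in> cube A \<Longrightarrow> f x \<in> {0, 1}" and mono: "mono_on (cube A) f"
    and f: "\<And>x. x \<in> cube A \<Longrightarrow> f x = biased_poly p A c x"
  defines "v \<equiv> p * (1 - p)"
  defines "W \<equiv> \<Sum>S\<in>Pow A. v ^ card S * (low_degree_part d c S)\<^sup>2"
  shows "mu A p f \<le> sqrt (mu A q f) * (sqrt W + sqrt (\<theta> ^ d * mu A p f))"
proof -
  define b where "b = low_degree_part d c"
  define h where "h S = c S - b S" for S
  define T where "T a = biased_poly q A (\<lambda>S. (p / q) ^ card S * a S)" for a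
  have f_sq: "(f x)\<^sup>2 = f x" if "x \<in> cube A" for x
    using f01[OF that] by auto
  have v: "0 < v" using p by (simp add: v_def)
  have T_sq: "mu A q (\<lambda>y. (T a y)\<^sup>2) \<le> (\<Sum>S\<in>Pow A. \<theta> ^ card S * (v ^ card S * (a S)\<^sup>2))" for a
  proof -
    have "mu A q (\<lambda>y. (T a y)\<^sup>2) = (\<Sum>S\<in>Pow A. (q * (1 - q) * (p / q)\<^sup>2) ^ card S * (a S)\<^sup>2)"
    proof -
      have "mu A q (\<lambda>y. (T a y)\<^sup>2) =
          (\<Sum>S\<in>Pow A. (q * (1 - q)) ^ card S * ((p / q) ^ card S * a S) * ((p / q) ^ card S * a S))"
        unfolding T_def power2_eq_square by (rule parseval) (use fin p in auto)
      also have "\<dots> = (\<Sum>S\<in>Pow A. (q * (1 - q) * (p / q)\<^sup>2) ^ card S * (a S)\<^sup>2)"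
        unfolding power_mult_distrib[of _ "(p / q)\<^sup>2"] power_mult[symmetric] mult.commute[of 2]
        unfolding power_mult power2_eq_square by (simp only: mult_ac)
      finally show ?thesis .
    qed
    also have "\<dots> \<le> (\<Sum>S\<in>Pow A. (\<theta> * v) ^ card S * (a S)\<^sup>2)"
    proof (intro sum_mono mult_right_mono power_mono)
      have "p / q \<le> \<theta>" using \<theta> p by (simp add: divide_le_eq)
      \<comment> \<open>One level of contraction:
        \<open>q * (1 - q) * (p / q)^2 = (p / q) * (p * (1 - q))\<close>, where
        \<open>p / q \<le> \<theta>\<close> and \<open>1 - q \<le> 1 - p\<close>.\<close>
      then have "(p / q) * (p * (1 - q)) \<le> \<theta> * (p * (1 - p))"
        using p \<theta> by (intro mult_mono) auto
      then show "q * (1 - q) * (p / q)\<^sup>2 \<le> \<theta> * v"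
        using p by (simp add: v_def power2_eq_square mult_ac)
    qed (use p in auto)
    finally show ?thesis by (simp add: power_mult_distrib mult.assoc)
  qed
  have CS: "mu A q (\<lambda>y. f y * t y) \<le> sqrt (mu A q f) * sqrt (mu A q (\<lambda>y. (t y)\<^sup>2))" for t
  proof -
    have "mu A q (\<lambda>y. (f y)\<^sup>2) = mu A q f" by (intro mu_cong[OF fin] f_sq)
    then show ?thesis
      using mu_Cauchy_Schwarz[OF fin, of q f t] by (simp add: real_le_rsqrt flip: real_sqrt_mult)
  qed
  have low: "mu A q (\<lambda>y. (T b y)\<^sup>2) \<le> W"
  proof (rule order_trans[OF T_sq], unfold W_def b_def, rule sum_mono)
    fix S
    show "\<theta> ^ card S * (v ^ card S * (low_degree_part d c S)\<^sup>2) \<le> v ^ card S * (low_degree_part d c S)\<^sup>2"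
      using v \<theta> by (intro mult_left_le_one_le power_le_one) auto
  qed
  have high: "mu A q (\<lambda>y. (T h y)\<^sup>2) \<le> \<theta> ^ d * mu A p f"
  proof -
    have "mu A q (\<lambda>y. (T h y)\<^sup>2) \<le> (\<Sum>S\<in>Pow A. \<theta> ^ d * (v ^ card S * c S * c S))"
    proof (rule order_trans[OF T_sq], rule sum_mono)
      fix S
      show "\<theta> ^ card S * (v ^ card S * (h S)\<^sup>2) \<le> \<theta> ^ d * (v ^ card S * c S * c S)"
      proof (cases "card S \<le> d")
        case False
        then have "\<theta> ^ card S \<le> \<theta> ^ d" using \<theta> by (intro power_decreasing) auto
        then have "\<theta> ^ card S * (v ^ card S * (c S)\<^sup>2) \<le> \<theta> ^ d * (v ^ card S * (c S)\<^sup>2)"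
          using v by (intro mult_right_mono) auto
        then show ?thesis
          using False by (simp add: h_def b_def low_degree_part_def power2_eq_square mult.assoc)
      qed (use v \<theta> in \<open>simp add: h_def b_def low_degree_part_def mult.assoc\<close>)
    qed
    also have "\<dots> = \<theta> ^ d * mu A p (\<lambda>x. biased_poly p A c x * biased_poly p A c x)"
      unfolding sum_distrib_left[symmetric] v_def using parseval[OF fin, of p c c] p by simp
    also have "mu A p (\<lambda>x. biased_poly p A c x * biased_poly p A c x) = mu A p f"
      using f f_sq by (intro mu_cong[OF fin]) (simp flip: power2_eq_square)
    finally show ?thesis .
  qed
  \<comment> \<open>For 0/1-valued monotone \<open>f\<close>, \<open>x \<le> y\<close> gives
    \<open>f x = f x * f y\<close>, so the noise bound applies with both \<open>h\<close> and
    \<open>g\<close> equal to \<open>f\<close>.\<close>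
  have "mu A p f \<le> mu A q (\<lambda>y. f y * T c y)"
    unfolding T_def
  proof (rule mu_le_one_sided_noise)
    fix x y assume "x \<in> cube A" "y \<in> cube A" "x \<le> y"
    then show "f x \<le> biased_poly p A c x * f y"
      using mono_onD[OF mono, of x y] f01[of x] f01[of y] f[of x] by auto
  qed (use fin p in auto)
  also have "\<dots> = mu A q (\<lambda>y. f y * T b y + f y * T h y)"
  proof -
    have "T c y = T b y + T h y" for y
      unfolding T_def biased_poly_add[symmetric] h_def by (simp add: algebra_simps)
    then show ?thesis by (simp add: distrib_left)
  qed
  also have "\<dots> = mu A q (\<lambda>y. f y * T b y) + mu A q (\<lambda>y. f y * T h y)"
    by (rule mu_add[OF fin])
  also have "\<dots> \<le> sqrt (mu A q f) * sqrt (mu A q (\<lambda>y. (T b y)\<^sup>2))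
      + sqrt (mu A q f) * sqrt (mu A q (\<lambda>y. (T h y)\<^sup>2))"
    by (intro add_mono CS)
  also have "\<dots> \<le> sqrt (mu A q f) * sqrt W + sqrt (mu A q f) * sqrt (\<theta> ^ d * mu A p f)"
    using low high f01 by (intro add_mono mult_left_mono real_sqrt_le_mono real_sqrt_ge_zero mu_nonneg[OF fin]) force+
  finally show ?thesis by (simp add: distrib_left)
qed

section \<open>Choice of parameters and conclusion\<close>

text \<open>The level \<open>d\<close> must lie within the range of globalness, be high enough for
  the noise to gain \<open>\<epsilon> / 16\<close>, and be low enough that the level-d inequality
  with \<open>\<eta> = 2 * \<delta>\<close> gives
  \<open>W \<le> \<epsilon> * \<mu>_p f / 16\<close>.\<close>

lemma threshold_parameters:
  fixes \<zeta> :: real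
  assumes "0 < \<zeta>"
  obtains C0 where "1 < C0"
    and "\<And>C \<epsilon>. C0 < C \<Longrightarrow> 0 < \<epsilon> \<Longrightarrow> \<epsilon> < 1 / 2 \<Longrightarrow>
      \<exists>d::nat. real d \<le> C * ln (inverse \<epsilon>) \<and> inverse (1 + \<zeta>) ^ d \<le> \<epsilon> / 16 \<and>
        128 ^ d * (2 * C powr (- (C * ln (inverse \<epsilon>)))) \<le> (\<epsilon> / 16) ^ 3"
proof
  define l where "l = ln (1 + \<zeta>)"
  \<comment> \<open>With \<open>L = ln (1 / \<epsilon>) \<ge> ln 2\<close>, the 5 comes from
    \<open>ln (16 / \<epsilon>) = L + 4 * ln 2 \<le> 5 * L\<close>, and the 2 absorbs rounding up,
    as \<open>1 \<le> 2 * L\<close>.\<close>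
  define K where "K = 5 / l + 2"
  have l: "0 < l" using assms by (simp add: l_def)
  then have K: "2 \<le> K" by (simp add: K_def)
  then show "1 < 7 * K + 16" by simp
  fix C \<epsilon> :: real
  assume C: "7 * K + 16 < C" and \<epsilon>: "0 < \<epsilon>" "\<epsilon> < 1 / 2"
  define L where "L = ln (inverse \<epsilon>)"
  have ln_eps: "ln \<epsilon> = - L" using \<epsilon> by (simp add: L_def ln_inverse)
  have ln2: "1 / 2 \<le> ln (2::real)" "ln (2::real) \<le> 1"
    using ln2_ge_two_thirds ln_2_less_1 by auto
  have "ln 2 \<le> L"
    unfolding L_def using \<epsilon> by (subst ln_le_cancel_iff) (auto simp: field_simps)
  note L = this ln2
  have ln16: "ln (16::real) = 4 * ln 2" and ln128: "ln (128::real) = 7 * ln 2"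
    using ln_realpow[of 2 4] ln_realpow[of 2 7] by simp_all
  define d where "d = nat \<lceil>5 * L / l\<rceil>"
  have "0 \<le> 5 * L / l" using L l by simp
  then have d_ge: "5 * L / l \<le> real d" and d_le: "real d \<le> 5 * L / l + 1"
    unfolding d_def by linarith+
  have "real d \<le> K * L"
    using d_le L by (simp add: K_def algebra_simps)
  moreover have "K * L \<le> C * L"
    using C K L by (intro mult_right_mono) auto
  ultimately have 1: "real d \<le> C * L" by simp

  have "5 * L \<le> real d * l" using d_ge l by (simp add: field_simps)
  then have "ln (inverse (1 + \<zeta>) ^ d) \<le> ln (\<epsilon> / 16)"
    using assms \<epsilon> L by (simp add: ln_realpow ln_inverse ln_div ln_eps ln16 l_def)
  then have 2: "inverse (1 + \<zeta>) ^ d \<le> \<epsilon> / 16"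
    using assms \<epsilon> by (subst (asm) ln_le_cancel_iff) auto

  have "exp 1 \<le> C" using exp_le C K by linarith
  then have "1 \<le> ln C" using C K by (subst ln_ge_iff) auto
  \<comment> \<open>In logarithms the third requirement is
    \<open>7 * ln 2 * d + 13 * ln 2 + 3 * L \<le> C * L * ln C\<close>. Since
    \<open>d \<le> K * L\<close> and \<open>ln 2 \<le> L\<close>, the left side is at most
    \<open>(7 * K + 16) * L\<close>.\<close>
  then have "(7 * K + 16) * L * 1 \<le> C * L * ln C"
    using C K L by (intro mult_mono) auto
  moreover have "real d * (7 * ln 2) \<le> (K * L) * 7"
    using \<open>real d \<le> K * L\<close> L K by (intro mult_mono) auto
  ultimately have "ln (128 ^ d * (2 * C powr (- (C * L)))) \<le> ln ((\<epsilon> / 16) ^ 3)"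
    using C K \<epsilon> L by (simp add: ln_mult ln_realpow ln_powr ln_div ln_eps ln16 ln128 algebra_simps)
  then have 3: "128 ^ d * (2 * C powr (- (C * L))) \<le> (\<epsilon> / 16) ^ 3"
    using C K \<epsilon> by (subst (asm) ln_le_cancel_iff) auto
  show "\<exists>d::nat. real d \<le> C * ln (inverse \<epsilon>) \<and> inverse (1 + \<zeta>) ^ d \<le> \<epsilon> / 16 \<and>
        128 ^ d * (2 * C powr (- (C * ln (inverse \<epsilon>)))) \<le> (\<epsilon> / 16) ^ 3"
    using 1 2 3 unfolding L_def by blast
qed

theorem theorem6p5:
  fixes \<zeta> :: real
  assumes "\<zeta> > 0"
  shows "\<exists>C0 > (1::real). \<forall>\<epsilon> p q C r \<delta> :: real.
           0 < \<epsilon> \<and> \<epsilon> < 1/2 \<and> 0 < p \<and> p < 1/2 \<and> 0 < q \<and> q < 1/2 \<and>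
           q \<ge> (1 + \<zeta>) * p \<and> C > C0 \<and> r = C * ln (inverse \<epsilon>) \<and> \<delta> = C powr (- r) \<longrightarrow>
           (\<forall>(n::nat) (f :: (nat \<Rightarrow> bool) \<Rightarrow> real).
              boolean_function n f \<and> mono_on (cube {1..n}) f \<and>
              global_function n p r \<delta> f \<and> mu {1..n} p f \<le> \<delta> \<longrightarrow>
              mu {1..n} q f \<ge> inverse \<epsilon> * mu {1..n} p f)"
proof -
  obtain C0 where "1 < C0" and C0: "\<And>C \<epsilon>. C0 < C \<Longrightarrow> 0 < \<epsilon> \<Longrightarrow> \<epsilon> < 1 / 2 \<Longrightarrow>
      \<exists>d::nat. real d \<le> C * ln (inverse \<epsilon>) \<and> inverse (1 + \<zeta>) ^ d \<le> \<epsilon> / 16 \<and>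
        128 ^ d * (2 * C powr (- (C * ln (inverse \<epsilon>)))) \<le> (\<epsilon> / 16) ^ 3"
    using threshold_parameters[OF assms] by metis
  have "inverse \<epsilon> * mu {1..n} p f \<le> mu {1..n} q f"
    if \<epsilon>: "0 < \<epsilon>" "\<epsilon> < 1 / 2" and p: "0 < p" "p < 1 / 2" and q: "0 < q" "q < 1 / 2" "(1 + \<zeta>) * p \<le> q"
      and C: "C0 < C" and r: "r = C * ln (inverse \<epsilon>)" and \<delta>: "\<delta> = C powr (- r)"
      and bool: "boolean_function n f" and mono: "mono_on (cube {1..n}) f"
      and glob: "global_function n p r \<delta> f" and small: "mu {1..n} p f \<le> \<delta>"
    for \<epsilon> p q C r \<delta> :: real and n and f :: "(nat \<Rightarrow> bool) \<Rightarrow> real"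
  proof (rule ccontr)
    let ?A = "{1..n}"
    define m where "m = mu ?A p f"
    define M where "M = mu ?A q f"
    assume "\<not> inverse \<epsilon> * mu ?A p f \<le> mu ?A q f"
    then have less: "\<epsilon> * M < m"
      using \<epsilon> by (simp add: m_def M_def field_simps)
    have f01: "f x \<in> {0, 1}" if "x \<in> cube ?A" for x
      using bool that by (auto simp: boolean_function_def)
    have "0 \<le> M"
      unfolding M_def using f01 by (intro mu_nonneg) (simp, fastforce)
    then have "0 \<le> \<epsilon> * M" using \<epsilon> by simp
    \<comment> \<open>The strict inequality of the negated claim excludes
      \<open>m = 0\<close>.\<close>
    then have m: "0 < m" using less by linarith
    obtain c where c: "\<And>x. x \<in> cube ?A \<Longrightarrow> f x = biased_poly p ?A c x"
      using biased_poly_exists[of ?A f p] by auto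
    obtain d :: nat where d: "real d \<le> r" and pow: "inverse (1 + \<zeta>) ^ d \<le> \<epsilon> / 16"
      and cubed: "128 ^ d * (2 * \<delta>) \<le> (\<epsilon> / 16) ^ 3"
      using C0[OF C \<epsilon>, folded r, folded \<delta>] by blast
    define W where "W = (\<Sum>S\<in>Pow ?A. (p * (1 - p)) ^ card S * (low_degree_part d c S)\<^sup>2)"
    have "W ^ 3 \<le> 128 ^ d * (2 * \<delta>) * m ^ 3"
      unfolding W_def m_def
    proof (rule level_d_inequality[OF _ _ _ f01 mono c])
      fix J assume J: "J \<subseteq> ?A" "card J \<le> d"
      then have "real (card J) \<le> r" using d by linarith
      then have "mu (?A - J) p (restrict_to_one f J) \<le> mu ?A p f + \<delta>"
        using J glob unfolding global_function_def by blast
      then show "mu (?A - J) p (restrict_to_one f J) \<le> 2 * \<delta>"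
        using small by simp
    qed (use p in auto)
    also have "\<dots> \<le> (\<epsilon> / 16) ^ 3 * m ^ 3"
      using cubed m by (intro mult_right_mono) auto
    finally have "W ^ 3 \<le> (\<epsilon> * m / 16) ^ 3"
      by (simp add: power_mult_distrib power_divide)
    then have W: "W \<le> \<epsilon> * m / 16"
      using \<epsilon> m by (auto intro: power_le_imp_le_base[where n = 2] simp: numeral_3_eq_3)
    have "p \<le> q" using q(3) p(1) assms by (smt (verit) mult_le_cancel_right1)
    \<comment> \<open>The contraction rate is \<open>\<theta> = inverse (1 + \<zeta>)\<close>; then
      \<open>p \<le> \<theta> * q\<close> restates the gap between \<open>p\<close> and
      \<open>q\<close>.\<close>
    then have "m \<le> sqrt M * (sqrt W + sqrt (inverse (1 + \<zeta>) ^ d * m))"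
      unfolding m_def M_def W_def using p q assms
      by (intro mu_le_low_degree_and_noise f01 mono c) (auto simp: field_simps)
    \<comment> \<open>Both square roots now equal \<open>sqrt (\<epsilon> * m) / 4\<close>, so the
      total is \<open>sqrt (\<epsilon> * M * m) / 2\<close>, and \<open>\<epsilon> * M < m\<close>
      forces \<open>m \<le> m / 2\<close>.\<close>
    also have "\<dots> \<le> sqrt M * (sqrt (\<epsilon> * m / 16) + sqrt (\<epsilon> / 16 * m))"
      using W pow m \<open>0 \<le> M\<close>
      by (intro mult_left_mono add_mono real_sqrt_le_mono mult_right_mono) auto
    also have "\<dots> = sqrt (\<epsilon> * M * m) / 2"
      by (simp add: real_sqrt_mult real_sqrt_divide)
    also have "sqrt (\<epsilon> * M * m) \<le> sqrt (m * m)"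
      using less m by (intro real_sqrt_le_mono mult_right_mono) auto
    finally show False using m by simp
  qed
  with \<open>1 < C0\<close> show ?thesis by blast
qed

end
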